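(* There exists an absolute constant $C>0$ such that for every probability space $(\Omega,\mu)$, every $N\in\mathbb N$ and every $N$-dimensional subspace $X_N$ of $L_2(\Omega,\mu)$ there are $N$ points $\xi^1,\dots,\xi^N\in\Omega$ (not necessarily distinct) such that $$\left(\frac1N\sum_{j=1}^N|f(\xi^j)|^2\right)^{1/2}\le C\|f\|_2\qquad\text{for all } f\in X_N.$$
   Context: Functions are measurable and defined at every point of $\Omega$ (functions differing on a set of measure zero are not identified). $\|f\|_2=\left(\int_\Omega|f|^2\,d\mu\right)^{1/2}$. *)

theory Defs
  imports "HOL-Probability.Probability" "HOL-Library.Function_Algebras"
begin

text \<open>Scalars \<open>'k\<close> are \<open>real\<close> or \<open>complex\<close>. Functions carry the pointwise vector space structure.\<close>

definition fun_scale :: "'k \<Rightarrow> ('a \<Rightarrow> 'k) \<Rightarrow> ('a \<Rightarrow> 'k::field)"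
  where "fun_scale c f = (\<lambda>x. c * f x)"

global_interpretation fun_vs: vector_space "fun_scale :: 'k::field \<Rightarrow> ('a \<Rightarrow> 'k) \<Rightarrow> ('a \<Rightarrow> 'k)"
  by unfold_locales (auto simp: fun_scale_def plus_fun_def fun_eq_iff algebra_simps)

text \<open>Functions on \<open>space M\<close> are represented by their extension by \<open>0\<close> to the whole type, so that
  HOL equality is equality at every point of \<open>space M\<close>. No almost-everywhere identification.\<close>

definition L2_space :: "'a measure \<Rightarrow> ('a \<Rightarrow> 'k::real_normed_field) set"
  where "L2_space M = {f. f \<in> borel_measurable M \<and> integrable M (\<lambda>x. (norm (f x))\<^sup>2) \<and>
                          (\<forall>x. x \<notin> space M \<longrightarrow> f x = 0)}"

definition L2_norm :: "'a measure \<Rightarrow> ('a \<Rightarrow> 'k::real_normed_field) \<Rightarrow> real"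
  where "L2_norm M f = sqrt (\<integral>x. (norm (f x))\<^sup>2 \<partial>M)"

text \<open>Finite generation is required separately because \<open>dim\<close> is \<open>0\<close> on
  infinite-dimensional spaces.\<close>

definition L2_subspace_of_dim ::
    "'a measure \<Rightarrow> nat \<Rightarrow> ('a \<Rightarrow> 'k::real_normed_field) set \<Rightarrow> bool"
  where "L2_subspace_of_dim M N X \<longleftrightarrow>
    X \<subseteq> L2_space M \<and> fun_vs.subspace X \<and>
    (\<exists>B. finite B \<and> fun_vs.span B = X) \<and> fun_vs.dim X = N"

text \<open>The type \<open>'a\<close> of sample points is universally quantified outside any formula, so a bare
  \<open>\<exists>C>0. \<forall>M :: 'a measure. \<dots>\<close> would let \<open>C\<close> depend on \<open>'a\<close>. An absolute constant is therefore
  expressed by bounding \<open>C\<close> by a numeral: the bound \<open>2\<close> comes from the one-sided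
  Batson-Spielman-Srivastava barrier argument (initial barrier \<open>2 * N\<close>, raised by \<open>2\<close> in each
  of \<open>N\<close> steps, hence \<open>C\<^sup>2 = 4\<close>).\<close>

end

theory Submission
  imports Defs
begin

text \<open>
  Let \<open>e\<^sub>0, \<dots>, e\<^bsub>n-1\<^esub>\<close> with \<open>n \<le> N\<close> be an orthonormal basis of \<open>X\<close> up to functions that vanish almost
  everywhere, and \<open>v x = (cnj (e\<^sub>i x))\<^sub>i\<close>. Points are chosen one at a time such that the operator
  \<open>B = u I - \<Sum>\<^sub>j (v \<xi>\<^sub>j) (v \<xi>\<^sub>j)\<^sup>*\<close> stays positive semidefinite and invertible with
  \<open>tr B\<^sup>-\<^sup>1 \<le> 1 / 2\<close>, where \<open>u\<close> starts at \<open>2 N\<close> and grows by \<open>2\<close> with every point. Raising \<open>u\<close>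
  lowers the trace by some \<open>\<Delta> \<ge> 2 tr Q\<^sup>2\<close>, where \<open>Q = (B + 2 I)\<^sup>-\<^sup>1\<close>. By Sherman--Morrison, subtracting
  \<open>(v x) (v x)\<^sup>*\<close> gives back at most \<open>\<Delta>\<close> as soon as \<open>\<Delta> \<langle>Q (v x), v x\<rangle> + \<langle>Q\<^sup>2 (v x), v x\<rangle> \<le> \<Delta>\<close>.
  The left-hand side has expectation \<open>\<Delta> tr Q + tr Q\<^sup>2 \<le> \<Delta>\<close>, so such points \<open>x\<close> exist, even
  outside a given null set. After \<open>N\<close> steps \<open>\<Sum>\<^sub>j \<bar>f \<xi>\<^sub>j\<bar>\<^sup>2 \<le> 4 N \<parallel>f\<parallel>\<^sup>2\<close>. Real spaces are complexified.
\<close>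

section \<open>The barrier operator\<close>

text \<open>Vectors of \<open>\<complex>\<^sup>n\<close> are sequences, of which \<open>ip n\<close> sees only the first \<open>n\<close> entries. The operators act on
  all sequences, so that inverses are honest inverses and no carrier sets are needed.\<close>

type_synonym cvec = "nat \<Rightarrow> complex"

definition ip :: "nat \<Rightarrow> cvec \<Rightarrow> cvec \<Rightarrow> complex"
  where "ip n x y = (\<Sum>i<n. x i * cnj (y i))"

definition unit :: "nat \<Rightarrow> cvec"
  where "unit k = (\<lambda>i. if i = k then 1 else 0)"

text \<open>Taking real parts loses nothing: the operators that occur are self-adjoint for
  \<open>ip n\<close>, so their diagonal entries are real.\<close>

definition trace :: "nat \<Rightarrow> (cvec \<Rightarrow> cvec) \<Rightarrow> real"
  where "trace n T = (\<Sum>k<n. Re (T (unit k) k))"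

lemma ip_add_left: "ip n (x + y) z = ip n x z + ip n y z"
  and ip_add_right: "ip n z (x + y) = ip n z x + ip n z y"
  and ip_diff_left: "ip n (x - y) z = ip n x z - ip n y z"
  and ip_diff_right: "ip n z (x - y) = ip n z x - ip n z y"
  and ip_scale_left: "ip n (fun_scale c x) z = c * ip n x z"
  and ip_scale_right: "ip n z (fun_scale c x) = cnj c * ip n z x"
  by (simp_all add: ip_def fun_scale_def algebra_simps sum.distrib sum_subtractf sum_distrib_left)

lemmas ip_simps = ip_add_left ip_add_right ip_diff_left ip_diff_right ip_scale_left ip_scale_right

lemma ip_zero_left: "ip n 0 z = 0"
  by (simp add: ip_def)

lemma cnj_ip: "cnj (ip n x y) = ip n y x"
  by (simp add: ip_def mult.commute)

lemma ip_self: "ip n x x = of_real (\<Sum>i<n. (cmod (x i))\<^sup>2)"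
  by (simp add: ip_def complex_norm_square[symmetric])

lemma Re_ip_self_nonneg: "0 \<le> Re (ip n x x)"
  by (simp add: ip_self sum_nonneg)

text \<open>\<open>ip n\<close> is only semidefinite on sequences. A null vector may have nonzero
  entries from index \<open>n\<close> on, so the conclusion is orthogonality to every
  \<open>y\<close> rather than \<open>x = 0\<close>.\<close>

lemma ip_eq_0_if_self_eq_0:
  assumes "Re (ip n x x) \<le> 0"
  shows "ip n x y = 0"
proof -
  have "(\<Sum>i<n. (cmod (x i))\<^sup>2) = 0"
    using assms sum_nonneg[of "{..<n}" "\<lambda>i. (cmod (x i))\<^sup>2"] by (simp add: ip_self)
  then have "\<forall>i<n. x i = 0"
    by (subst (asm) sum_nonneg_eq_0_iff) auto
  then show ?thesis by (simp add: ip_def)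
qed

lemma ip_unit_left: "k < n \<Longrightarrow> ip n (unit k) x = cnj (x k)"
  and ip_unit_right: "k < n \<Longrightarrow> ip n x (unit k) = x k"
  by (simp_all add: ip_def unit_def if_distrib[of cnj] mult_delta_left mult_delta_right)
     (simp_all add: if_distrib[of "(*) _"] cong: if_cong)

lemma trace_eq_sum_ip: "trace n T = (\<Sum>k<n. Re (ip n (T (unit k)) (unit k)))"
  by (simp add: trace_def ip_unit_right)

definition barrier :: "nat \<Rightarrow> real \<Rightarrow> cvec list \<Rightarrow> cvec \<Rightarrow> cvec"
  where "barrier n u vs x = (\<lambda>i. of_real u * x i - (\<Sum>v\<leftarrow>vs. ip n x v * v i))"

lemma barrier_Nil [simp]: "barrier n u [] x = fun_scale (of_real u) x"
  and barrier_Cons [simp]: "barrier n u (v # vs) x = barrier n u vs x - fun_scale (ip n x v) v"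
  by (auto simp: barrier_def fun_scale_def fun_eq_iff)

lemma barrier_add: "barrier n u vs (x + y) = barrier n u vs x + barrier n u vs y"
  by (auto simp: barrier_def fun_eq_iff ip_simps algebra_simps sum_list_addf)

lemma barrier_scale: "barrier n u vs (fun_scale c x) = fun_scale c (barrier n u vs x)"
  by (auto simp: barrier_def fun_scale_def fun_eq_iff ip_simps[unfolded fun_scale_def] algebra_simps
      sum_list_const_mult)

lemma barrier_raise: "barrier n (u + d) vs x = barrier n u vs x + fun_scale (of_real d) x"
  by (auto simp: barrier_def fun_scale_def fun_eq_iff algebra_simps)

lemma ip_barrier: "ip n (barrier n u vs x) y = of_real u * ip n x y - (\<Sum>v\<leftarrow>vs. ip n x v * ip n v y)"
  by (induction vs) (simp_all only: barrier_Nil barrier_Cons ip_simps list.map sum_list.Nil sum_list.Cons, simp_all)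

lemma barrier_sym: "ip n (barrier n u vs x) y = ip n x (barrier n u vs y)"
proof -
  have "ip n x (barrier n u vs y) = cnj (ip n (barrier n u vs y) x)"
    by (simp only: cnj_ip)
  also have "\<dots> = of_real u * ip n x y - (\<Sum>v\<leftarrow>vs. ip n x v * ip n v y)"
    unfolding ip_barrier by (induction vs) (simp_all add: cnj_ip mult.commute)
  finally show ?thesis by (simp only: ip_barrier)
qed

text \<open>With the coefficients of a function f as \<open>x\<close> and
  \<open>coord n e \<xi>\<close> as \<open>v\<close>, \<open>ip n x v\<close> is the value of f at
  \<xi> outside a null set. Nonnegativity of this form is therefore the sampling inequality.\<close>

lemma ip_barrier_self:
  "ip n (barrier n u vs x) x = of_real (u * (\<Sum>i<n. (cmod (x i))\<^sup>2) - (\<Sum>v\<leftarrow>vs. (cmod (ip n x v))\<^sup>2))"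
proof -
  have "ip n x v * ip n v x = of_real ((cmod (ip n x v))\<^sup>2)" for v
    by (metis cnj_ip complex_norm_square)
  then have "(\<Sum>v\<leftarrow>vs. ip n x v * ip n v x) = of_real (\<Sum>v\<leftarrow>vs. (cmod (ip n x v))\<^sup>2)"
    by (induction vs) (simp_all del: of_real_power)
  then show ?thesis by (simp add: ip_barrier ip_self)
qed

section \<open>Inverses of the barrier operator\<close>

definition inverse_of :: "(cvec \<Rightarrow> cvec) \<Rightarrow> (cvec \<Rightarrow> cvec) \<Rightarrow> bool"
  where "inverse_of B R \<longleftrightarrow> (\<forall>x. R (B x) = x) \<and> (\<forall>x. B (R x) = x)"

text \<open>A two-sided inverse inherits additivity, and below also homogeneity, symmetry and
  positivity, from the barrier operator: write each argument as
  \<open>barrier n u vs (R x)\<close>.\<close>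

lemma inverse_barrier_add:
  assumes "inverse_of (barrier n u vs) R"
  shows "R (x + y) = R x + R y"
  using assms unfolding inverse_of_def by (metis barrier_add)

lemma inverse_barrier_scale:
  assumes "inverse_of (barrier n u vs) R"
  shows "R (fun_scale c x) = fun_scale c (R x)"
  using assms unfolding inverse_of_def by (metis barrier_scale)

lemma inverse_barrier_diff:
  assumes "inverse_of (barrier n u vs) R"
  shows "R (x - y) = R x - R y"
  by (metis assms diff_add_cancel add_diff_cancel_right' inverse_barrier_add)

lemma inverse_barrier_sym:
  assumes "inverse_of (barrier n u vs) R"
  shows "ip n (R x) y = ip n x (R y)"
  using assms unfolding inverse_of_def by (metis barrier_sym)

lemma inverse_barrier_psd:
  assumes "inverse_of (barrier n u vs) R" "\<And>x. 0 \<le> Re (ip n (barrier n u vs x) x)"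
  shows "0 \<le> Re (ip n (R x) x)"
  using assms unfolding inverse_of_def by (metis barrier_sym)

lemma Re_ip_inverse_barrier:
  assumes "inverse_of (barrier n u vs) R"
  shows "ip n (R x) x = of_real (Re (ip n (R x) x))"
proof -
  have "cnj (ip n (R x) x) = ip n (R x) x"
    by (simp only: cnj_ip inverse_barrier_sym[OF assms])
  then show ?thesis by (simp add: Reals_cnj_iff of_real_Re)
qed

text \<open>The Sherman--Morrison formula\<close>

lemma inverse_barrier_Cons:
  assumes R: "inverse_of (barrier n u vs) R" and s: "ip n (R v) v \<noteq> 1"
  shows "inverse_of (barrier n u (v # vs)) (\<lambda>x. R x + fun_scale (ip n (R x) v / (1 - ip n (R v) v)) (R v))"
proof -
  let ?s = "ip n (R v) v"
  have s': "1 - ?s \<noteq> 0" using s by simp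
  have RB: "R (barrier n u vs x) = x" "barrier n u vs (R x) = x" for x
    using R by (auto simp: inverse_of_def)
  show ?thesis
    unfolding inverse_of_def
  proof (intro conjI allI)
    fix x
    \<comment> \<open>Here \<open>R\<close> returns \<open>x\<close> minus \<open>ip n x v\<close>
      times \<open>R v\<close>. The inner product of this with \<open>v\<close> is
      \<open>ip n x v * (1 - ?s)\<close>, so dividing by \<open>1 - ?s\<close> recovers the missing
      multiple of \<open>R v\<close>.\<close>
    have "(ip n x v - ip n x v * ?s) / (1 - ?s) = ip n x v"
      using s' by (simp add: field_simps)
    then show "R (barrier n u (v # vs) x) + fun_scale (ip n (R (barrier n u (v # vs) x)) v / (1 - ?s)) (R v) = x"
      by (simp add: RB inverse_barrier_diff[OF R] inverse_barrier_scale[OF R] ip_simps)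
    define c where "c = ip n (R x) v / (1 - ?s)"
    have c: "c - (ip n (R x) v + c * ?s) = 0"
      using s' by (simp add: c_def field_simps)
    have "barrier n u (v # vs) (R x + fun_scale c (R v))
        = x + fun_scale (c - (ip n (R x) v + c * ?s)) v"
      by (simp add: RB barrier_add barrier_scale ip_simps)
         (simp add: fun_eq_iff fun_scale_def algebra_simps)
    then show "barrier n u (v # vs) (R x + fun_scale (ip n (R x) v / (1 - ?s)) (R v)) = x"
      unfolding c by (simp add: c_def)
  qed
qed

lemma barrier_psd_antimono:
  assumes "d * Re (ip n x x) \<le> Re (ip n (barrier n u (v # vs) x) x)"
  shows "d * Re (ip n x x) \<le> Re (ip n (barrier n u vs x) x)"
proof -
  have "Re (ip n (barrier n u (v # vs) x) x) \<le> Re (ip n (barrier n u vs x) x)"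
    unfolding ip_barrier_self by simp
  with assms show ?thesis by simp
qed

text \<open>The vectors are subtracted one at a time, and the lower bound \<open>d\<close> holds for
  every shorter list as well. Sherman--Morrison fails only if \<open>ip n (R v) v = 1\<close>; then
  \<open>R v\<close> would lie in the kernel of the new operator, hence be null by the bound, hence
  be orthogonal to \<open>v\<close>.\<close>

lemma barrier_inverse_exists:
  assumes "0 < u" "0 < d" "\<And>x. d * Re (ip n x x) \<le> Re (ip n (barrier n u vs x) x)"
  shows "\<exists>R. inverse_of (barrier n u vs) R"
  using assms(3)
proof (induction vs)
  case Nil
  then show ?case
    using \<open>0 < u\<close> by (intro exI[of _ "fun_scale (of_real (1 / u))"]) (simp add: inverse_of_def)
next
  case (Cons v vs)
  obtain R where R: "inverse_of (barrier n u vs) R"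
    using Cons.IH[OF barrier_psd_antimono[OF Cons.prems]] by blast
  have "ip n (R v) v \<noteq> 1"
  proof
    assume 1: "ip n (R v) v = 1"
    have "barrier n u (v # vs) (R v) = 0"
      using R 1 by (simp add: inverse_of_def)
    then have "d * Re (ip n (R v) (R v)) \<le> 0"
      using Cons.prems[of "R v"] by (simp only: ip_zero_left zero_complex.sel)
    then have "Re (ip n (R v) (R v)) \<le> 0"
      using \<open>0 < d\<close> by (simp add: mult_le_0_iff)
    then show False
      using 1 by (auto dest: ip_eq_0_if_self_eq_0[where y = v])
  qed
  then show ?case using inverse_barrier_Cons[OF R] by blast
qed

text \<open>This is Cauchy--Schwarz for the form of B: if B z = v, then the squared modulus of
  \<open>ip n x v\<close> is at most the form at \<open>x\<close> times the form at z, and the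
  latter is \<open>ip n (R v) v\<close>.\<close>

lemma barrier_Cons_psd:
  assumes R: "inverse_of (barrier n u vs) R"
    and psd: "\<And>x. 0 \<le> Re (ip n (barrier n u vs x) x)"
    and s: "Re (ip n (R v) v) \<le> 1"
  shows "0 \<le> Re (ip n (barrier n u (v # vs) x) x)"
proof -
  let ?B = "barrier n u vs"
  define t where "t = ip n x v"
  define z where "z = R v"
  have Bz: "?B z = v" using R by (simp add: z_def inverse_of_def)
  \<comment> \<open>Nonnegativity of the form at this vector yields the Cauchy--Schwarz bound
    without dividing by \<open>ip n z v\<close>.\<close>
  define y where "y = x - fun_scale t z"
  have By: "?B y = ?B x - fun_scale t v"
    by (metis Bz barrier_add barrier_scale add_diff_cancel_right' diff_add_cancel y_def)
  have tt: "t * cnj t = of_real ((cmod t)\<^sup>2)" by (simp only: complex_norm_square)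
  have vx: "ip n v x = cnj t" by (simp add: t_def cnj_ip)
  have Bxz: "ip n (?B x) z = t" by (simp add: barrier_sym Bz t_def)
  have vz: "ip n v z = of_real (Re (ip n z v))"
    unfolding z_def by (metis R Re_ip_inverse_barrier complex_cnj_complex_of_real cnj_ip)
  have "ip n (?B y) y = ip n (?B x) x - 2 * (t * cnj t) + t * cnj t * of_real (Re (ip n z v))"
    unfolding By by (simp add: y_def ip_simps vx Bxz vz algebra_simps)
  then have "Re (ip n (?B y) y) = Re (ip n (?B x) x) - 2 * (cmod t)\<^sup>2 + (cmod t)\<^sup>2 * Re (ip n z v)"
    unfolding tt by simp
  moreover have "0 \<le> Re (ip n (?B y) y)" by (rule psd)
  moreover have "(cmod t)\<^sup>2 * Re (ip n z v) \<le> (cmod t)\<^sup>2 * 1"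
    using s by (intro mult_left_mono) (auto simp: z_def)
  ultimately have "(cmod t)\<^sup>2 \<le> Re (ip n (?B x) x)" by simp
  then show ?thesis by (simp add: ip_simps vx tt flip: t_def)
qed

text \<open>The Sherman--Morrison correction is a multiple of the rank-one operator built from
  \<open>R v\<close>, whose trace is the squared norm of \<open>R v\<close>. If the denominator is
  0, both corrections are 0 by the convention for division by zero.\<close>

lemma trace_inverse_barrier_Cons:
  assumes R: "inverse_of (barrier n u vs) R"
  shows "trace n (\<lambda>x. R x + fun_scale (ip n (R x) v / (1 - ip n (R v) v)) (R v))
      = trace n R + Re (ip n (R v) (R v)) / (1 - Re (ip n (R v) v))"
proof -
  define s where "s = Re (ip n (R v) v)"
  have s: "ip n (R v) v = of_real s"
    unfolding s_def by (rule Re_ip_inverse_barrier[OF R])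
  have "Re (ip n (R (unit k)) v / (1 - of_real s) * R v k) = (cmod (R v k))\<^sup>2 / (1 - s)" if "k < n" for k
  proof -
    have "ip n (R (unit k)) v / (1 - of_real s) * R v k = R v k * cnj (R v k) / of_real (1 - s)"
      using that by (simp add: inverse_barrier_sym[OF R] ip_unit_left)
    also have "\<dots> = of_real ((cmod (R v k))\<^sup>2 / (1 - s))"
      by (simp only: complex_norm_square of_real_divide)
    finally show ?thesis by (simp only: Re_complex_of_real)
  qed
  then have "trace n (\<lambda>x. R x + fun_scale (ip n (R x) v / (1 - of_real s)) (R v))
      = (\<Sum>k<n. Re (R (unit k) k) + (cmod (R v k))\<^sup>2 / (1 - s))"
    unfolding trace_def by (intro sum.cong refl) (simp only: fun_scale_def plus_fun_apply plus_complex.sel lessThan_iff)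
  also have "\<dots> = trace n R + Re (ip n (R v) (R v)) / (1 - s)"
    by (simp add: trace_def sum.distrib ip_self sum_divide_distrib)
  finally show ?thesis by (simp only: s Re_complex_of_real)
qed

text \<open>The resolvent identities P = M + 2 P M and P = M + 2 M P combine to P = M + 2 M^2 + 4 M
  P M, whose last term is positive semidefinite. The sum in the statement is the trace of
  M^2.\<close>

lemma trace_inverse_raise:
  assumes P: "inverse_of (barrier n u vs) P" and psd: "\<And>x. 0 \<le> Re (ip n (barrier n u vs x) x)"
    and M: "inverse_of (barrier n (u + 2) vs) M"
  shows "trace n M + 2 * (\<Sum>k<n. Re (ip n (M (unit k)) (M (unit k)))) \<le> trace n P"
proof -
  have PM: "P x = M x + fun_scale 2 (P (M x))" for x
  proof -
    have "x = barrier n u vs (M x) + fun_scale 2 (M x)"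
      using M barrier_raise[of n u 2 vs "M x"] by (simp add: inverse_of_def)
    then have "P x = P (barrier n u vs (M x) + fun_scale 2 (M x))" by simp
    also have "\<dots> = M x + fun_scale 2 (P (M x))"
      using P by (simp add: inverse_barrier_add[OF P] inverse_barrier_scale[OF P]) (simp add: inverse_of_def)
    finally show ?thesis .
  qed
  have MP: "P x = M x + fun_scale 2 (M (P x))" for x
  proof -
    have "barrier n (u + 2) vs (P x) = x + fun_scale 2 (P x)"
      using P barrier_raise[of n u 2 vs "P x"] by (simp add: inverse_of_def)
    then have "M (barrier n (u + 2) vs (P x)) = M (x + fun_scale 2 (P x))" by simp
    then show ?thesis
      using M by (simp add: inverse_barrier_add[OF M] inverse_barrier_scale[OF M]) (simp add: inverse_of_def)
  qed
  have "Re (ip n (M e) e) + 2 * Re (ip n (M e) (M e)) \<le> Re (ip n (P e) e)" for e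
  proof -
    have "ip n (P e) e = ip n (M e + fun_scale 2 (P (M e))) e" by (subst PM) (rule refl)
    also have "\<dots> = ip n (M e) e + 2 * ip n (P (M e)) e" by (simp only: ip_simps)
    also have "ip n (P (M e)) e = ip n (M (M e) + fun_scale 2 (M (P (M e)))) e" by (subst MP) (rule refl)
    also have "\<dots> = ip n (M e) (M e) + 2 * ip n (P (M e)) (M e)"
      by (simp only: ip_simps inverse_barrier_sym[OF M])
    finally have "Re (ip n (P e) e) = Re (ip n (M e) e) + 2 * Re (ip n (M e) (M e)) + 4 * Re (ip n (P (M e)) (M e))"
      by simp
    moreover have "0 \<le> Re (ip n (P (M e)) (M e))"
      by (rule inverse_barrier_psd[OF P psd])
    ultimately show ?thesis by simp
  qed
  then show ?thesis
    unfolding trace_eq_sum_ip sum_distrib_left sum.distrib[symmetric] by (intro sum_mono)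
qed

text \<open>Here \<open>u\<close> is the already raised barrier. The condition on \<open>v\<close>
  says that the squared norm of \<open>M v\<close> is at most \<open>\<Delta> * (1 - s)\<close>,
  which bounds the trace increase by \<open>\<Delta>\<close>.\<close>

lemma barrier_step:
  assumes M: "inverse_of (barrier n u vs) M" and psd: "\<And>x. 0 \<le> Re (ip n (barrier n u vs x) x)"
    and \<Delta>: "0 \<le> \<Delta>"
    and v: "\<Delta> * Re (ip n (M v) v) + Re (ip n (M v) (M v)) \<le> \<Delta>"
  shows "\<exists>R. inverse_of (barrier n u (v # vs)) R \<and> trace n R \<le> trace n M + \<Delta> \<and>
    (\<forall>x. 0 \<le> Re (ip n (barrier n u (v # vs) x) x))"
proof -
  define s where "s = Re (ip n (M v) v)"
  have s: "ip n (M v) v = of_real s" unfolding s_def by (rule Re_ip_inverse_barrier[OF M])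
  have le: "Re (ip n (M v) (M v)) \<le> \<Delta> * (1 - s)"
    using v by (simp add: s_def algebra_simps)
  \<comment> \<open>If \<open>M v\<close> is null then \<open>s = 0\<close>; otherwise
    \<open>\<Delta> * (1 - s)\<close> is positive.\<close>
  have "s < 1"
  proof (cases "Re (ip n (M v) (M v)) \<le> 0")
    case True
    from ip_eq_0_if_self_eq_0[OF this] show ?thesis by (simp add: s_def)
  next
    case False
    then have "0 < \<Delta> * (1 - s)" using le by linarith
    then show ?thesis using \<Delta> by (simp add: zero_less_mult_iff)
  qed
  define R where "R = (\<lambda>x. M x + fun_scale (ip n (M x) v / (1 - ip n (M v) v)) (M v))"
  have "inverse_of (barrier n u (v # vs)) R"
    unfolding R_def using \<open>s < 1\<close> by (intro inverse_barrier_Cons[OF M]) (simp add: s)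
  moreover have "trace n R \<le> trace n M + \<Delta>"
    unfolding R_def trace_inverse_barrier_Cons[OF M] using \<open>s < 1\<close> le
    by (simp add: divide_le_eq flip: s_def)
  moreover have "\<forall>x. 0 \<le> Re (ip n (barrier n u (v # vs) x) x)"
    using barrier_Cons_psd[OF M psd, of v] \<open>s < 1\<close> by (simp add: s_def)
  ultimately show ?thesis by blast
qed

section \<open>Expansion in unit vectors\<close>

lemma sum_fun_apply: "(\<Sum>i\<in>I. f i) x = (\<Sum>i\<in>I. f i x)"
  by (induction I rule: infinite_finite_induct) auto

lemma ip_sum_left: "ip n (\<Sum>i\<in>I. f i) y = (\<Sum>i\<in>I. ip n (f i) y)"
  by (simp add: ip_def sum_fun_apply sum_distrib_right sum.swap[of _ I])

lemma ip_sum_right: "ip n y (\<Sum>i\<in>I. f i) = (\<Sum>i\<in>I. ip n y (f i))"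
  by (simp add: ip_def sum_fun_apply sum_distrib_left sum.swap[of _ I])

lemma unit_expansion:
  assumes "\<And>i. i \<ge> n \<Longrightarrow> v i = 0"
  shows "v = (\<Sum>k<n. fun_scale (v k) (unit k))"
proof
  fix i
  have "(\<Sum>k<n. v k * (if i = k then 1 else 0)) = (\<Sum>k<n. if i = k then v k else 0)"
    by (intro sum.cong) auto
  then show "v i = (\<Sum>k<n. fun_scale (v k) (unit k)) i"
    using assms[of i] by (simp add: sum_fun_apply fun_scale_def unit_def)
qed

lemma inverse_barrier_expansion:
  assumes R: "inverse_of (barrier n u vs) R" and v: "\<And>i. i \<ge> n \<Longrightarrow> v i = 0"
  shows "R v = (\<Sum>k<n. fun_scale (v k) (R (unit k)))"
proof -
  have R0: "R 0 = 0"
    using inverse_barrier_scale[OF R, of 0 0] by (simp only: fun_vs.scale_zero_left)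
  have "R (\<Sum>k\<in>K. fun_scale (v k) (unit k)) = (\<Sum>k\<in>K. fun_scale (v k) (R (unit k)))" if "finite K" for K
    using that
    by (induction K rule: finite_induct) (simp_all only: R0 sum.empty sum.insert inverse_barrier_add[OF R] inverse_barrier_scale[OF R] not_False_eq_True)
  from this[of "{..<n}"] show ?thesis
    by (simp only: finite_lessThan flip: unit_expansion[OF v])
qed

section \<open>Almost everywhere orthonormal bases\<close>

lemma L2_spaceD:
  fixes f :: "'a \<Rightarrow> complex"
  assumes "f \<in> L2_space M"
  shows "f \<in> borel_measurable M" "integrable M (\<lambda>x. (cmod (f x))\<^sup>2)"
  using assms by (auto simp: L2_space_def)

lemma L2_subspace: "fun_vs.subspace (L2_space M :: ('a \<Rightarrow> complex) set)"
proof (rule fun_vs.subspaceI)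
  show "(0 :: 'a \<Rightarrow> complex) \<in> L2_space M"
    by (simp add: L2_space_def zero_fun_def)
next
  fix f g :: "'a \<Rightarrow> complex" assume f: "f \<in> L2_space M" and g: "g \<in> L2_space M"
  have "(cmod (a + b))\<^sup>2 \<le> 2 * (cmod a)\<^sup>2 + 2 * (cmod b)\<^sup>2" for a b
  proof -
    have "(cmod (a + b))\<^sup>2 \<le> (cmod a + cmod b)\<^sup>2"
      by (intro power_mono norm_triangle_ineq) simp
    also have "\<dots> \<le> 2 * (cmod a)\<^sup>2 + 2 * (cmod b)\<^sup>2"
      using sum_squares_bound[of "cmod a" "cmod b"] by (simp add: power2_sum)
    finally show ?thesis .
  qed
  moreover have "integrable M (\<lambda>x. 2 * (cmod (f x))\<^sup>2 + 2 * (cmod (g x))\<^sup>2)"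
    using L2_spaceD[OF f] L2_spaceD[OF g] by (intro Bochner_Integration.integrable_add integrable_mult_right)
  ultimately have "integrable M (\<lambda>x. (cmod (f x + g x))\<^sup>2)"
    using L2_spaceD[OF f] L2_spaceD[OF g]
    by (elim Bochner_Integration.integrable_bound) (auto intro!: borel_measurable_power)
  then show "f + g \<in> L2_space M"
    using f g by (auto simp: L2_space_def plus_fun_def)
next
  fix c :: complex and f :: "'a \<Rightarrow> complex" assume "f \<in> L2_space M"
  then show "fun_scale c f \<in> L2_space M"
    by (auto simp: L2_space_def fun_scale_def norm_mult power_mult_distrib)
qed

lemma L2_integrable_mult:
  fixes f g :: "'a \<Rightarrow> complex"
  assumes f: "f \<in> L2_space M" and g: "g \<in> L2_space M"
  shows "integrable M (\<lambda>x. f x * cnj (g x))"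
proof (rule Bochner_Integration.integrable_bound)
  show "integrable M (\<lambda>x. (cmod (f x))\<^sup>2 + (cmod (g x))\<^sup>2)"
    using L2_spaceD[OF f] L2_spaceD[OF g] by auto
  have [measurable]: "f \<in> borel_measurable M" "g \<in> borel_measurable M"
    using f g by (auto dest: L2_spaceD)
  have "(\<lambda>x. cnj (g x)) \<in> borel_measurable M"
    using measurable_compose[OF \<open>g \<in> borel_measurable M\<close> borel_measurable_continuous_onI[of cnj]]
    by (simp add: continuous_on_cnj)
  then show "(\<lambda>x. f x * cnj (g x)) \<in> borel_measurable M" by measurable
  have "a * b \<le> a\<^sup>2 + b\<^sup>2" if "0 \<le> a" "0 \<le> b" for a b :: real
    using sum_squares_bound[of a b] that mult_nonneg_nonneg[OF that] by linarith
  then show "AE x in M. norm (f x * cnj (g x)) \<le> norm ((cmod (f x))\<^sup>2 + (cmod (g x))\<^sup>2)"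
    by (auto simp: norm_mult)
qed

definition orthonormal :: "'a measure \<Rightarrow> nat \<Rightarrow> (nat \<Rightarrow> 'a \<Rightarrow> complex) \<Rightarrow> bool"
  where "orthonormal M n e \<longleftrightarrow> (\<forall>i<n. e i \<in> L2_space M) \<and>
    (\<forall>i<n. \<forall>j<n. (\<integral>x. e i x * cnj (e j x) \<partial>M) = (if i = j then 1 else 0))"

text \<open>By orthonormality the mean of a quadratic expression in the basis functions is the trace
  of its coefficient matrix. This serves both Parseval, with \<open>K k l = c k * cnj (c l)\<close>,
  and the averaging over points in the barrier step.\<close>

lemma orthonormal_quadratic:
  assumes e: "orthonormal M n e"
  shows "integrable M (\<lambda>x. \<Sum>k<n. \<Sum>l<n. K k l * (e k x * cnj (e l x)))"
    and "(\<integral>x. (\<Sum>k<n. \<Sum>l<n. K k l * (e k x * cnj (e l x))) \<partial>M) = (\<Sum>k<n. K k k)"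
proof -
  have int: "integrable M (\<lambda>x. K k l * (e k x * cnj (e l x)))" if "k < n" "l < n" for k l
    using that e by (intro integrable_mult_right L2_integrable_mult) (auto simp: orthonormal_def)
  then show "integrable M (\<lambda>x. \<Sum>k<n. \<Sum>l<n. K k l * (e k x * cnj (e l x)))"
    by (intro Bochner_Integration.integrable_sum) auto
  have "(\<integral>x. (\<Sum>k<n. \<Sum>l<n. K k l * (e k x * cnj (e l x))) \<partial>M)
      = (\<Sum>k<n. \<Sum>l<n. \<integral>x. K k l * (e k x * cnj (e l x)) \<partial>M)"
    using int by (subst Bochner_Integration.integral_sum; intro Bochner_Integration.integrable_sum sum.cong
        Bochner_Integration.integral_sum refl) auto
  also have "\<dots> = (\<Sum>k<n. \<Sum>l<n. if k = l then K k l else 0)"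
    using e by (intro sum.cong refl) (auto simp: orthonormal_def)
  finally show "(\<integral>x. (\<Sum>k<n. \<Sum>l<n. K k l * (e k x * cnj (e l x))) \<partial>M) = (\<Sum>k<n. K k k)"
    by simp
qed

lemma orthonormal_Parseval:
  assumes e: "orthonormal M n e" and Z: "Z \<in> null_sets M" and f: "f \<in> L2_space M"
    and eq: "\<And>x. x \<in> space M - Z \<Longrightarrow> f x = (\<Sum>i<n. c i * e i x)"
  shows "(\<integral>x. (cmod (f x))\<^sup>2 \<partial>M) = (\<Sum>i<n. (cmod (c i))\<^sup>2)"
proof -
  have AE: "AE x in M. of_real ((cmod (f x))\<^sup>2) = (\<Sum>k<n. \<Sum>l<n. c k * cnj (c l) * (e k x * cnj (e l x)))"
  proof (rule AE_I'[OF Z], rule subsetI, rule ccontr)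
    fix x assume "x \<in> {x \<in> space M. of_real ((cmod (f x))\<^sup>2) \<noteq> (\<Sum>k<n. \<Sum>l<n. c k * cnj (c l) * (e k x * cnj (e l x)))}"
      and "x \<notin> Z"
    moreover from this have "f x * cnj (f x) = (\<Sum>k<n. \<Sum>l<n. c k * cnj (c l) * (e k x * cnj (e l x)))"
      by (simp add: eq sum_product mult.assoc mult.left_commute)
    ultimately show False by (simp only: complex_norm_square mem_Collect_eq) simp
  qed
  have "of_real (\<integral>x. (cmod (f x))\<^sup>2 \<partial>M) = (\<integral>x. of_real ((cmod (f x))\<^sup>2) \<partial>M :: complex)"
    by (rule integral_complex_of_real[symmetric])
  also have "\<dots> = (\<integral>x. (\<Sum>k<n. \<Sum>l<n. c k * cnj (c l) * (e k x * cnj (e l x))) \<partial>M)"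
    using L2_spaceD(1)[OF f] AE
    by (intro integral_cong_AE)
       (auto intro!: borel_measurable_integrable orthonormal_quadratic(1)[OF e] borel_measurable_of_real)
  also have "\<dots> = (\<Sum>k<n. c k * cnj (c k))"
    by (rule orthonormal_quadratic(2)[OF e])
  also have "\<dots> = of_real (\<Sum>k<n. (cmod (c k))\<^sup>2)"
    by (simp only: complex_norm_square of_real_sum)
  finally show ?thesis by (simp only: of_real_eq_iff)
qed

text \<open>A Gram--Schmidt step. The residual \<open>h\<close> can vanish almost everywhere without
  being the zero function; then the basis does not grow and the set where \<open>h\<close> is
  nonzero is absorbed into \<open>Z\<close>.\<close>

lemma orthonormal_extend:
  fixes g :: "'a \<Rightarrow> complex"
  assumes e: "orthonormal M n e" and g: "g \<in> L2_space M"
  shows "\<exists>n' e' Z c. n' \<le> Suc n \<and> orthonormal M n' e' \<and> Z \<in> null_sets M \<and> n \<le> n' \<and> (\<forall>i<n. e' i = e i) \<and>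
    (\<forall>x\<in>space M - Z. g x = (\<Sum>i<n'. c i * e' i x))"
proof -
  define a where "a i = (\<integral>x. g x * cnj (e i x) \<partial>M)" for i
  define h where "h = g - (\<Sum>i<n. fun_scale (a i) (e i))"
  have e_L2: "e i \<in> L2_space M" if "i < n" for i using e that by (simp add: orthonormal_def)
  have h: "h \<in> L2_space M"
    unfolding h_def using e_L2 g
    by (intro fun_vs.subspace_diff fun_vs.subspace_sum fun_vs.subspace_scale L2_subspace) auto
  have h_eq: "h x = g x - (\<Sum>i<n. a i * e i x)" for x
    by (simp add: h_def sum_fun_apply fun_scale_def)
  have orth: "(\<integral>x. h x * cnj (e j x) \<partial>M) = 0" if j: "j < n" for j
  proof -
    have "(\<integral>x. h x * cnj (e j x) \<partial>M) = (\<integral>x. g x * cnj (e j x) - (\<Sum>i<n. a i * (e i x * cnj (e j x))) \<partial>M)"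
      by (simp add: h_eq left_diff_distrib sum_distrib_right mult.assoc)
    also have "\<dots> = a j - (\<Sum>i<n. a i * (\<integral>x. e i x * cnj (e j x) \<partial>M))"
      unfolding a_def using j e_L2 g
      by (subst Bochner_Integration.integral_diff Bochner_Integration.integral_sum;
          auto intro!: L2_integrable_mult Bochner_Integration.integrable_sum)+
    also have "(\<Sum>i<n. a i * (\<integral>x. e i x * cnj (e j x) \<partial>M)) = (\<Sum>i<n. if i = j then a i else 0)"
      using e j by (intro sum.cong) (auto simp: orthonormal_def)
    finally show ?thesis using j by simp
  qed
  have orth': "(\<integral>x. e j x * cnj (h x) \<partial>M) = 0" if "j < n" for j
  proof -
    have "(\<integral>x. e j x * cnj (h x) \<partial>M) = cnj (\<integral>x. h x * cnj (e j x) \<partial>M)"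
      by (simp add: mult.commute flip: Bochner_Integration.integral_cnj)
    then show ?thesis using orth[OF that] by simp
  qed
  define s where "s = (\<integral>x. (cmod (h x))\<^sup>2 \<partial>M)"
  have "0 \<le> s" by (simp add: s_def)
  show ?thesis
  proof (cases "s = 0")
    case True
    have "AE x in M. (cmod (h x))\<^sup>2 = 0"
      using True L2_spaceD(2)[OF h] unfolding s_def
      by (subst (asm) integral_nonneg_eq_0_iff_AE) auto
    then obtain Z where "Z \<in> null_sets M" "{x \<in> space M. \<not> (cmod (h x))\<^sup>2 = 0} \<subseteq> Z"
      by (auto simp: eventually_ae_filter)
    moreover from this have "\<forall>x\<in>space M - Z. g x = (\<Sum>i<n. a i * e i x)"
      using h_eq by auto
    ultimately show ?thesis
      using e by (intro exI[of _ n] exI[of _ e] exI[of _ Z] exI[of _ a]) auto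
  next
    case False
    \<comment> \<open>\<open>r\<close> is the norm of \<open>h\<close>: dividing by it normalizes
      the new basis function, and it is the coefficient of \<open>g\<close> along that
      function.\<close>
    define r where "r = (of_real (sqrt s) :: complex)"
    have r: "r \<noteq> 0" "cnj r = r" "r * r = of_real s"
      using False \<open>0 \<le> s\<close> by (auto simp: r_def simp flip: of_real_mult)
    define e' where "e' = e(n := fun_scale (1 / r) h)"
    have hh: "(\<integral>x. h x * cnj (h x) \<partial>M) = of_real s"
      unfolding s_def by (simp only: flip: complex_norm_square integral_complex_of_real)
    have ort: "(\<integral>x. e' i x * cnj (e' j x) \<partial>M) = (if i = j then 1 else 0)" if ij: "i < Suc n" "j < Suc n" for i j
    proof -
      consider "i < n" "j < n" | "i = n" "j < n" | "i < n" "j = n" | "i = n" "j = n"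
        using ij by linarith
      then show ?thesis
      proof cases
        case 1 then show ?thesis using e by (auto simp: e'_def orthonormal_def)
      next
        case 2 then show ?thesis using orth[of j] by (simp add: e'_def fun_scale_def)
      next
        case 3 then show ?thesis using orth'[of i] by (simp add: e'_def fun_scale_def)
      next
        case 4
        have "(\<integral>x. e' i x * cnj (e' j x) \<partial>M) = (\<integral>x. (1 / (r * r)) * (h x * cnj (h x)) \<partial>M)"
          using 4 by (simp add: e'_def fun_scale_def r)
        also have "\<dots> = 1 / (r * r) * (\<integral>x. h x * cnj (h x) \<partial>M)" by (rule integral_mult_right_zero)
        also have "\<dots> = 1" using r False by (simp add: hh)
        finally show ?thesis using 4 by simp
      qed
    qed
    have "e' i \<in> L2_space M" if "i < Suc n" for i
      using that e_L2 h by (auto simp: e'_def less_Suc_eq intro!: fun_vs.subspace_scale[OF L2_subspace])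
    with ort have "orthonormal M (Suc n) e'"
      by (simp add: orthonormal_def)
    moreover have "g x = (\<Sum>i<Suc n. (a(n := r)) i * e' i x)" for x
    proof -
      have "(\<Sum>i<n. (a(n := r)) i * e' i x) = (\<Sum>i<n. a i * e i x)"
        by (intro sum.cong) (auto simp: e'_def)
      then show ?thesis using h_eq[of x] r by (simp add: e'_def fun_scale_def)
    qed
    ultimately show ?thesis
      by (intro exI[of _ "Suc n"] exI[of _ e'] exI[of _ "{}"] exI[of _ "a(n := r)"]) (auto simp: e'_def)
  qed
qed

text \<open>One null set must serve every function of the span, since the points are chosen before
  \<open>f\<close>. Uniting the null sets of finitely many generators suffices, because the
  functions that are combinations of the basis off a fixed \<open>Z\<close> form a subspace.\<close>

lemma orthonormal_span:
  fixes G :: "('a \<Rightarrow> complex) set"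
  assumes "finite G" "G \<subseteq> L2_space M"
  shows "\<exists>n e Z. n \<le> card G \<and> orthonormal M n e \<and> Z \<in> null_sets M \<and>
    (\<forall>f\<in>fun_vs.span G. \<exists>c. \<forall>x\<in>space M - Z. f x = (\<Sum>i<n. c i * e i x))"
proof -
  have "\<exists>n e Z. n \<le> card G \<and> orthonormal M n e \<and> Z \<in> null_sets M \<and>
    (\<forall>f\<in>G. \<exists>c. \<forall>x\<in>space M - Z. f x = (\<Sum>i<n. c i * e i x))"
    using assms
  proof (induction G rule: finite_induct)
    case empty
    show ?case by (intro exI[of _ 0] exI[of _ "{}"]) (simp add: orthonormal_def)
  next
    case (insert g G)
    then obtain n e Z where IH: "n \<le> card G" "orthonormal M n e" "Z \<in> null_sets M"
      "\<And>f. f \<in> G \<Longrightarrow> \<exists>c. \<forall>x\<in>space M - Z. f x = (\<Sum>i<n. c i * e i x)"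
      by auto
    obtain n' e' Z' c where ext: "n' \<le> Suc n" "orthonormal M n' e'" "Z' \<in> null_sets M" "n \<le> n'"
      "\<And>i. i < n \<Longrightarrow> e' i = e i" "\<forall>x\<in>space M - Z'. g x = (\<Sum>i<n'. c i * e' i x)"
      using orthonormal_extend[OF IH(2)] insert.prems by blast
    have "\<exists>c. \<forall>x\<in>space M - (Z \<union> Z'). f x = (\<Sum>i<n'. c i * e' i x)" if f: "f \<in> insert g G" for f
    proof (cases "f = g")
      case True
      with ext(6) show ?thesis by blast
    next
      case False
      then obtain d where d: "\<forall>x\<in>space M - Z. f x = (\<Sum>i<n. d i * e i x)"
        using IH(4) f by blast
      \<comment> \<open>Old coefficient vectors are padded with zeros when the basis grows.\<close>
      have "(\<Sum>i<n'. (if i < n then d i else 0) * e' i x) = (\<Sum>i<n. d i * e i x)" for x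
        using ext(4,5) by (intro sum.mono_neutral_cong_right) auto
      with d show ?thesis by (intro exI[of _ "\<lambda>i. if i < n then d i else 0"]) auto
    qed
    moreover have "n' \<le> card (insert g G)"
      using insert.hyps IH(1) ext(1) by simp
    moreover have "Z \<union> Z' \<in> null_sets M" using IH(3) ext(3) by auto
    ultimately show ?case using ext(2) by blast
  qed
  then obtain n e Z where *: "n \<le> card G" "orthonormal M n e" "Z \<in> null_sets M"
    "\<And>f. f \<in> G \<Longrightarrow> \<exists>c. \<forall>x\<in>space M - Z. f x = (\<Sum>i<n. c i * e i x)"
    by blast
  let ?S = "{f. \<exists>c. \<forall>x\<in>space M - Z. f x = (\<Sum>i<n. c i * e i x)}"
  have "fun_vs.subspace ?S"
  proof (rule fun_vs.subspaceI)
    show "0 \<in> ?S" by (auto intro!: exI[of _ "\<lambda>_. 0"])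
  next
    fix f g assume "f \<in> ?S" "g \<in> ?S"
    then obtain c d where "\<forall>x\<in>space M - Z. f x = (\<Sum>i<n. c i * e i x)"
      "\<forall>x\<in>space M - Z. g x = (\<Sum>i<n. d i * e i x)" by blast
    then show "f + g \<in> ?S"
      by (auto intro!: exI[of _ "\<lambda>i. c i + d i"] simp: distrib_right sum.distrib)
  next
    fix r f assume "f \<in> ?S"
    then obtain c where "\<forall>x\<in>space M - Z. f x = (\<Sum>i<n. c i * e i x)" by blast
    then show "fun_scale r f \<in> ?S"
      by (auto intro!: exI[of _ "\<lambda>i. r * c i"] simp: fun_scale_def sum_distrib_left mult.assoc)
  qed
  then have "fun_vs.span G \<subseteq> ?S"
    using *(4) by (intro fun_vs.span_minimal) auto
  with *(1-3) show ?thesis by blast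
qed

section \<open>Choice of the points\<close>

text \<open>Otherwise \<open>F\<close> exceeds \<open>D\<close> almost everywhere, and so does its
  mean. Avoiding \<open>Z\<close> keeps the points where the basis expansions are valid.\<close>

lemma (in prob_space) exists_le_expectation:
  fixes F :: "'a \<Rightarrow> real"
  assumes F: "integrable M F" and D: "expectation F \<le> D" and Z: "Z \<in> null_sets M"
  shows "\<exists>x\<in>space M - Z. F x \<le> D"
proof (rule ccontr)
  assume "\<not> ?thesis"
  then have "AE x in M. D < F x"
    by (intro AE_I'[OF Z]) force
  then have "(\<integral>x. D \<partial>M) < expectation F"
    using F by (intro integral_less_AE_space) (auto simp: emeasure_space_1)
  with D show False by (simp add: prob_space)
qed

text \<open>The conjugation turns \<open>ip n c (coord n e x)\<close> into the value at
  \<open>x\<close> of the combination with coefficients \<open>c\<close>. The zero tail makes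
  \<open>unit_expansion\<close> applicable.\<close>

definition coord :: "nat \<Rightarrow> (nat \<Rightarrow> 'a \<Rightarrow> complex) \<Rightarrow> 'a \<Rightarrow> cvec"
  where "coord n e x = (\<lambda>i. if i < n then cnj (e i x) else 0)"

lemma ip_coord: "ip n c (coord n e x) = (\<Sum>i<n. c i * e i x)"
  by (simp add: ip_def coord_def)

lemma (in prob_space) barrier_point:
  assumes e: "orthonormal M n e" and Z: "Z \<in> null_sets M"
    and P: "inverse_of (barrier n u vs) P" and psd: "\<And>x. 0 \<le> Re (ip n (barrier n u vs x) x)"
    and u: "0 < u" and tr: "trace n P \<le> 1 / 2"
  shows "\<exists>\<omega>\<in>space M - Z. (\<exists>R. inverse_of (barrier n (u + 2) (coord n e \<omega> # vs)) R \<and> trace n R \<le> 1 / 2) \<and>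
    (\<forall>x. 0 \<le> Re (ip n (barrier n (u + 2) (coord n e \<omega> # vs) x) x))"
proof -
  \<comment> \<open>Raising the barrier by 2 turns semidefiniteness into the lower bound 2, so the
    raised operator is invertible.\<close>
  have psd2: "2 * Re (ip n x x) \<le> Re (ip n (barrier n (u + 2) vs x) x)" for x
    using psd[of x] by (simp add: barrier_raise ip_simps)
  then have psd': "0 \<le> Re (ip n (barrier n (u + 2) vs x) x)" for x
    using Re_ip_self_nonneg[of n x] by (smt (verit))
  obtain Q where Q: "inverse_of (barrier n (u + 2) vs) Q"
    using barrier_inverse_exists[of "u + 2" 2, OF _ _ psd2] u by auto
  define \<Delta> where "\<Delta> = trace n P - trace n Q"
  define S where "S = (\<Sum>k<n. Re (ip n (Q (unit k)) (Q (unit k))))"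
  have S: "2 * S \<le> \<Delta>"
    using trace_inverse_raise[OF P psd Q] by (simp add: S_def \<Delta>_def)
  have "0 \<le> S" unfolding S_def by (intro sum_nonneg Re_ip_self_nonneg)
  with S have \<Delta>: "0 \<le> \<Delta>" by simp
  \<comment> \<open>The indices are swapped because \<open>coord\<close> conjugates.
    \<open>F\<close> then is the left-hand side of the condition in \<open>barrier_step\<close>, and
    the diagonal of \<open>K\<close> sums to \<Delta> tr Q + tr Q^2.\<close>
  define K where "K k l = of_real \<Delta> * ip n (Q (unit l)) (unit k) + ip n (Q (unit l)) (Q (unit k))" for k l
  define F where "F = (\<lambda>x. \<Sum>k<n. \<Sum>l<n. K k l * (e k x * cnj (e l x)))"
  have F_eq: "F x = of_real \<Delta> * ip n (Q (coord n e x)) (coord n e x) + ip n (Q (coord n e x)) (Q (coord n e x))" for x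
  proof -
    let ?v = "coord n e x"
    have v: "?v i = 0" if "i \<ge> n" for i using that by (simp add: coord_def)
    have Qv: "Q ?v = (\<Sum>l<n. fun_scale (?v l) (Q (unit l)))"
      by (rule inverse_barrier_expansion[OF Q v])
    have "ip n (Q ?v) ?v = ip n (Q ?v) (\<Sum>k<n. fun_scale (?v k) (unit k))"
      by (simp flip: unit_expansion[OF v])
    also have "\<dots> = (\<Sum>k<n. \<Sum>l<n. cnj (?v k) * (?v l * ip n (Q (unit l)) (unit k)))"
      unfolding Qv by (simp only: ip_sum_left ip_sum_right ip_simps sum_distrib_left)
    finally have 1: "ip n (Q ?v) ?v = (\<Sum>k<n. \<Sum>l<n. cnj (?v k) * (?v l * ip n (Q (unit l)) (unit k)))" .
    have 2: "ip n (Q ?v) (Q ?v) = (\<Sum>k<n. \<Sum>l<n. cnj (?v k) * (?v l * ip n (Q (unit l)) (Q (unit k))))"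
      unfolding Qv by (simp only: ip_sum_left ip_sum_right ip_simps sum_distrib_left)
    show ?thesis
      unfolding 1 2 F_def sum_distrib_left sum.distrib[symmetric]
      by (intro sum.cong refl) (simp add: K_def coord_def algebra_simps)
  qed
  have "expectation (\<lambda>x. Re (F x)) = Re (\<Sum>k<n. K k k)"
    unfolding F_def using orthonormal_quadratic[OF e, of K] by (simp only: integral_Re)
  also have "\<dots> = \<Delta> * trace n Q + S"
    by (simp add: K_def S_def trace_eq_sum_ip sum.distrib sum_distrib_left)
  \<comment> \<open>The first half comes from
    \<open>trace n Q = trace n P - \<Delta> \<le> 1 / 2\<close>, the second from
    \<open>2 * S \<le> \<Delta>\<close>.\<close>
  also have "\<dots> \<le> \<Delta> * (1 / 2) + \<Delta> * (1 / 2)"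
    using \<Delta> S tr by (intro add_mono mult_left_mono) (auto simp: \<Delta>_def)
  finally have "expectation (\<lambda>x. Re (F x)) \<le> \<Delta>" by simp
  moreover have "integrable M (\<lambda>x. Re (F x))"
    unfolding F_def by (intro integrable_Re orthonormal_quadratic(1)[OF e])
  ultimately obtain \<omega> where \<omega>: "\<omega> \<in> space M - Z" "Re (F \<omega>) \<le> \<Delta>"
    using exists_le_expectation[OF _ _ Z] by blast
  then have "\<Delta> * Re (ip n (Q (coord n e \<omega>)) (coord n e \<omega>)) + Re (ip n (Q (coord n e \<omega>)) (Q (coord n e \<omega>))) \<le> \<Delta>"
    unfolding F_eq by (simp only: plus_complex.sel Re_complex_of_real times_complex.sel Im_complex_of_real mult_zero_left diff_zero)
  from barrier_step[OF Q psd' \<Delta> this] obtain R where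
    "inverse_of (barrier n (u + 2) (coord n e \<omega> # vs)) R" "trace n R \<le> trace n Q + \<Delta>"
    "\<forall>x. 0 \<le> Re (ip n (barrier n (u + 2) (coord n e \<omega> # vs) x) x)" by blast
  moreover from this have "trace n R \<le> 1 / 2" using tr by (simp add: \<Delta>_def)
  ultimately show ?thesis using \<omega>(1) by blast
qed

lemma (in prob_space) barrier_points:
  assumes e: "orthonormal M n e" and Z: "Z \<in> null_sets M" and N: "n \<le> N" "0 < N"
  shows "\<exists>xs. length xs = j \<and> set xs \<subseteq> space M - Z \<and>
    (\<exists>P. inverse_of (barrier n (2 * N + 2 * j) (map (coord n e) xs)) P \<and> trace n P \<le> 1 / 2) \<and>
    (\<forall>x. 0 \<le> Re (ip n (barrier n (2 * N + 2 * j) (map (coord n e) xs) x) x))"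
proof (induction j)
  case 0
  \<comment> \<open>The initial inverse has trace \<open>n / (2 * N)\<close>, which is at most
    \<open>1 / 2\<close> because \<open>n \<le> N\<close>.\<close>
  let ?P = "fun_scale (of_real (1 / (2 * N))) :: cvec \<Rightarrow> cvec"
  have "inverse_of (barrier n (2 * N + 2 * (0::nat)) []) ?P"
    using N by (simp add: inverse_of_def)
  moreover have "trace n ?P \<le> 1 / 2"
    using N by (simp add: trace_def fun_scale_def unit_def field_simps)
  moreover have "0 \<le> Re (ip n (barrier n (2 * N + 2 * (0::nat)) [] x) x)" for x
    by (simp add: ip_simps Re_ip_self_nonneg)
  ultimately show ?case by fastforce
next
  case (Suc j)
  then obtain xs P where xs: "length xs = j" "set xs \<subseteq> space M - Z"
    and P: "inverse_of (barrier n (2 * N + 2 * j) (map (coord n e) xs)) P" "trace n P \<le> 1 / 2"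
    and psd: "\<And>x. 0 \<le> Re (ip n (barrier n (2 * N + 2 * j) (map (coord n e) xs) x) x)"
    by blast
  have "0 < real (2 * N + 2 * j)" using N by simp
  from barrier_point[OF e Z P(1) psd this P(2)] obtain \<omega> R where
    "\<omega> \<in> space M - Z" "inverse_of (barrier n (real (2 * N + 2 * j) + 2) (map (coord n e) (\<omega> # xs))) R" "trace n R \<le> 1 / 2"
    "\<And>x. 0 \<le> Re (ip n (barrier n (real (2 * N + 2 * j) + 2) (map (coord n e) (\<omega> # xs)) x) x)"
    unfolding list.map by blast
  moreover have "real (2 * N + 2 * j) + 2 = real (2 * N + 2 * Suc j)" by simp
  ultimately show ?case
    using xs by (intro exI[of _ "\<omega> # xs"] conjI exI[of _ R] allI) (auto simp only: length_Cons list.set insert_subset)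
qed

text \<open>Stating this for spans of at most \<open>N\<close> functions makes it apply directly to
  a complexified real basis.\<close>

lemma (in prob_space) sampling_bound:
  fixes G :: "('a \<Rightarrow> complex) set"
  assumes G: "finite G" "G \<subseteq> L2_space M" "card G \<le> N"
  shows "\<exists>\<xi>::nat \<Rightarrow> 'a. (\<forall>j\<in>{1..N}. \<xi> j \<in> space M) \<and>
    (\<forall>f\<in>fun_vs.span G. sqrt (1 / real N * (\<Sum>j=1..N. (cmod (f (\<xi> j)))\<^sup>2)) \<le> 2 * L2_norm M f)"
proof (cases "N = 0")
  case True
  \<comment> \<open>For \<open>N = 0\<close> the sum is empty and the left-hand side is 0.\<close>
  then show ?thesis by (simp add: L2_norm_def)
next
  case False
  obtain n e Z where n: "n \<le> card G" and e: "orthonormal M n e" and Z: "Z \<in> null_sets M"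
    and span: "\<And>f. f \<in> fun_vs.span G \<Longrightarrow> \<exists>c. \<forall>x\<in>space M - Z. f x = (\<Sum>i<n. c i * e i x)"
    using orthonormal_span[OF G(1,2)] by blast
  have "n \<le> N" using n G(3) by simp
  from barrier_points[OF e Z this, of N] False obtain xs where xs: "length xs = N" "set xs \<subseteq> space M - Z"
    and psd: "\<And>x. 0 \<le> Re (ip n (barrier n (2 * N + 2 * N) (map (coord n e) xs) x) x)"
    by blast
  \<comment> \<open>List positions start at 0, sample indices at 1.\<close>
  have pts: "xs ! (j - 1) \<in> space M - Z" if "j \<in> {1..N}" for j
    using that xs by (metis One_nat_def Suc_le_D Suc_le_lessD atLeastAtMost_iff diff_Suc_1 nth_mem subsetD)
  have "sqrt (1 / real N * (\<Sum>j=1..N. (cmod (f (xs ! (j - 1))))\<^sup>2)) \<le> 2 * L2_norm M f"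
    if f: "f \<in> fun_vs.span G" for f
  proof -
    obtain c where c: "\<And>x. x \<in> space M - Z \<Longrightarrow> f x = (\<Sum>i<n. c i * e i x)"
      using span[OF f] by blast
    have "f \<in> L2_space M"
      using f fun_vs.span_minimal[OF G(2) L2_subspace] by blast
    from orthonormal_Parseval[OF e Z this c]
    have norm: "(\<integral>x. (cmod (f x))\<^sup>2 \<partial>M) = (\<Sum>i<n. (cmod (c i))\<^sup>2)" .
    have "(\<Sum>j=1..N. (cmod (f (xs ! (j - 1))))\<^sup>2) = (\<Sum>j<N. (cmod (f (xs ! j)))\<^sup>2)"
      by (rule sum.reindex_bij_witness[of _ Suc "\<lambda>j. j - 1"]) auto
    also have "\<dots> = (\<Sum>j<N. (cmod (ip n c (coord n e (xs ! j))))\<^sup>2)"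
      using xs c nth_mem[of _ xs] by (intro sum.cong refl) (simp add: ip_coord subset_iff)
    also have "\<dots> = (\<Sum>v\<leftarrow>map (coord n e) xs. (cmod (ip n c v))\<^sup>2)"
      using xs by (simp add: sum_list_sum_nth atLeast0LessThan)
    \<comment> \<open>The barrier has reached \<open>4 * N\<close> after \<open>N\<close> steps, so
      nonnegativity of its form at the coefficient vector \<open>c\<close> is this bound.\<close>
    also have "\<dots> \<le> 4 * N * (\<Sum>i<n. (cmod (c i))\<^sup>2)"
      using psd[of c] unfolding ip_barrier_self by simp
    finally have "1 / real N * (\<Sum>j=1..N. (cmod (f (xs ! (j - 1))))\<^sup>2) \<le> 2\<^sup>2 * (\<integral>x. (cmod (f x))\<^sup>2 \<partial>M)"
      using False by (simp add: norm field_simps)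
    then have "sqrt (1 / real N * (\<Sum>j=1..N. (cmod (f (xs ! (j - 1))))\<^sup>2)) \<le> sqrt (2\<^sup>2 * (\<integral>x. (cmod (f x))\<^sup>2 \<partial>M))"
      by (rule real_sqrt_le_mono)
    then show ?thesis by (simp only: L2_norm_def real_sqrt_mult real_sqrt_power power2_eq_square) simp
  qed
  with pts show ?thesis by (intro exI[of _ "\<lambda>j. xs ! (j - 1)"]) auto
qed

section \<open>Bases of subspaces and complexification\<close>

lemma L2_subspace_basis:
  assumes "L2_subspace_of_dim M N X"
  shows "\<exists>B. finite B \<and> B \<subseteq> L2_space M \<and> card B = N \<and> fun_vs.span B = X"
proof -
  obtain A where A: "finite A" "fun_vs.span A = X" and X: "X \<subseteq> L2_space M" "fun_vs.dim X = N" "fun_vs.subspace X"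
    using assms by (auto simp: L2_subspace_of_dim_def)
  obtain B where B: "B \<subseteq> X" "fun_vs.independent B" "X \<subseteq> fun_vs.span B" "card B = fun_vs.dim X"
    using fun_vs.basis_exists by blast
  have "finite B"
    using fun_vs.independent_span_bound[OF A(1) B(2)] B(1) A(2) by auto
  moreover have "fun_vs.span B = X"
    using fun_vs.span_minimal[OF B(1) X(3)] B(3) by auto
  ultimately show ?thesis using B X by blast
qed

text \<open>This places a real space inside the complex span of its complexified basis, where
  \<open>sampling_bound\<close> applies; absolute values and norms are unchanged.\<close>

lemma complexification_in_span:
  fixes f :: "'a \<Rightarrow> real"
  assumes "f \<in> fun_vs.span B"
  shows "(\<lambda>x. complex_of_real (f x)) \<in> fun_vs.span ((\<lambda>g x. complex_of_real (g x)) ` B)"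
proof -
  let ?c = "\<lambda>g x. complex_of_real (g x)"
  let ?S = "{f. ?c f \<in> fun_vs.span (?c ` B)}"
  have "fun_vs.subspace ?S"
  proof (rule fun_vs.subspaceI)
    show "0 \<in> ?S" using fun_vs.span_zero[of "?c ` B"] by (simp add: zero_fun_def)
  next
    fix f g assume "f \<in> ?S" "g \<in> ?S"
    then show "f + g \<in> ?S"
      using fun_vs.span_add[of "?c f" "?c ` B" "?c g"] by (simp add: plus_fun_def)
  next
    fix r f assume "f \<in> ?S"
    then show "fun_scale r f \<in> ?S"
      using fun_vs.span_scale[of "?c f" "?c ` B" "of_real r"] by (simp add: fun_scale_def)
  qed
  then have "fun_vs.span B \<subseteq> ?S"
    by (intro fun_vs.span_minimal) (auto intro: fun_vs.span_base)
  with assms show ?thesis by blast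
qed

theorem proposition4p1:
  "\<exists>C::real. 0 < C \<and> C \<le> 2 \<and>
     (\<forall>(M :: 'a measure) (N :: nat) (X :: ('a \<Rightarrow> real) set).
        prob_space M \<longrightarrow> L2_subspace_of_dim M N X \<longrightarrow>
        (\<exists>\<xi> :: nat \<Rightarrow> 'a. (\<forall>j\<in>{1..N}. \<xi> j \<in> space M) \<and>
           (\<forall>f\<in>X. sqrt (1 / real N * (\<Sum>j=1..N. (norm (f (\<xi> j)))\<^sup>2)) \<le> C * L2_norm M f))) \<and>
     (\<forall>(M :: 'a measure) (N :: nat) (X :: ('a \<Rightarrow> complex) set).
        prob_space M \<longrightarrow> L2_subspace_of_dim M N X \<longrightarrow>
        (\<exists>\<xi> :: nat \<Rightarrow> 'a. (\<forall>j\<in>{1..N}. \<xi> j \<in> space M) \<and>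
           (\<forall>f\<in>X. sqrt (1 / real N * (\<Sum>j=1..N. (norm (f (\<xi> j)))\<^sup>2)) \<le> C * L2_norm M f)))"
proof (intro exI[of _ 2] conjI allI impI)
  fix M :: "'a measure" and N and X :: "('a \<Rightarrow> real) set"
  assume M: "prob_space M" and "L2_subspace_of_dim M N X"
  then obtain B where B: "finite B" "B \<subseteq> L2_space M" "card B = N" "fun_vs.span B = X"
    using L2_subspace_basis by blast
  let ?c = "\<lambda>(g :: 'a \<Rightarrow> real) x. complex_of_real (g x)"
  have "?c ` B \<subseteq> L2_space M"
    using B(2) by (auto simp: L2_space_def)
  moreover have "card (?c ` B) \<le> N" using card_image_le[OF B(1)] B(3) by blast
  ultimately obtain \<xi> where \<xi>: "\<forall>j\<in>{1..N}. \<xi> j \<in> space M"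
    "\<And>f. f \<in> fun_vs.span (?c ` B) \<Longrightarrow> sqrt (1 / real N * (\<Sum>j=1..N. (cmod (f (\<xi> j)))\<^sup>2)) \<le> 2 * L2_norm M f"
    using prob_space.sampling_bound[OF M, of "?c ` B" N] B(1) by blast
  have "sqrt (1 / real N * (\<Sum>j=1..N. (norm (f (\<xi> j)))\<^sup>2)) \<le> 2 * L2_norm M f" if "f \<in> X" for f
    using \<xi>(2)[OF complexification_in_span[of f B]] that B(4) by (simp add: L2_norm_def)
  with \<xi>(1) show "\<exists>\<xi> :: nat \<Rightarrow> 'a. (\<forall>j\<in>{1..N}. \<xi> j \<in> space M) \<and>
      (\<forall>f\<in>X. sqrt (1 / real N * (\<Sum>j=1..N. (norm (f (\<xi> j)))\<^sup>2)) \<le> 2 * L2_norm M f)" by blast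
next
  fix M :: "'a measure" and N and X :: "('a \<Rightarrow> complex) set"
  assume M: "prob_space M" and "L2_subspace_of_dim M N X"
  then obtain B where B: "finite B" "B \<subseteq> L2_space M" "card B = N" "fun_vs.span B = X"
    using L2_subspace_basis by blast
  then show "\<exists>\<xi> :: nat \<Rightarrow> 'a. (\<forall>j\<in>{1..N}. \<xi> j \<in> space M) \<and>
      (\<forall>f\<in>X. sqrt (1 / real N * (\<Sum>j=1..N. (norm (f (\<xi> j)))\<^sup>2)) \<le> 2 * L2_norm M f)"
    using prob_space.sampling_bound[OF M, of B N] by simp
qed simp_all

end
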